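(* Let $n\ge2$ and let $\Omega\subset\mathbb{H}^n$ be a domain with $\partial_\infty\Omega=\{p\}$ for a single point $p\in\partial_\infty\mathbb{H}^n$. Then for every $\lambda\in[0,(n-1)^2/4]$ there is no nontrivial bounded function $u\in C(\overline\Omega)\cap C^2(\Omega)$ with $-\Delta u=\lambda u$ in $\Omega$ and $u=0$ on $\partial\Omega$.
   Context: $\Delta$ is the Laplace–Beltrami operator of $\mathbb{H}^n$; a domain is an open connected set. $\partial_\infty\mathbb{H}^n$ is the set of classes of unit-speed geodesic rays at bounded distance from one another, and $\partial_\infty\Omega$ is the boundary of $\Omega$ in $\mathbb{H}^n\cup\partial_\infty\mathbb{H}^n$ with the cone topology, minus its boundary in $\mathbb{H}^n$. *)

theory Defs
  imports "HOL-Analysis.Analysis"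
begin

text \<open>Upper half-space model of hyperbolic n-space: points (x,t) with x in an
(n-1)-dimensional Euclidean space 'a and t > 0; metric (|dx|^2 + dt^2)/t^2.
Here n = DIM('a) + 1.\<close>

definition hyp_space :: "('a::euclidean_space \<times> real) set" where
  "hyp_space = {p. snd p > 0}"

definition dderiv :: "('a::euclidean_space \<Rightarrow> real) \<Rightarrow> 'a \<Rightarrow> 'a \<Rightarrow> real" where
  "dderiv u v x = frechet_derivative u (at x) v"

definition C2_on :: "'a::euclidean_space set \<Rightarrow> ('a \<Rightarrow> real) \<Rightarrow> bool" where
  "C2_on S u \<longleftrightarrow>
     (\<forall>x\<in>S. u differentiable at x) \<and>
     (\<forall>b\<in>Basis. \<forall>x\<in>S. dderiv u b differentiable at x) \<and>
     (\<forall>b\<in>Basis. \<forall>c\<in>Basis. continuous_on S (dderiv (dderiv u b) c))"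

definition eucl_laplacian :: "('a::euclidean_space \<Rightarrow> real) \<Rightarrow> 'a \<Rightarrow> real" where
  "eucl_laplacian u x = (\<Sum>b\<in>Basis. dderiv (dderiv u b) b x)"

text \<open>Laplace--Beltrami operator of H^n in the upper half-space model:
  t^2 (Euclidean Laplacian) - (n - 2) t d/dt, with n = DIM('a) + 1.\<close>
definition hyp_laplacian :: "('a::euclidean_space \<times> real \<Rightarrow> real) \<Rightarrow> 'a \<times> real \<Rightarrow> real" where
  "hyp_laplacian u p =
     (snd p)^2 * eucl_laplacian u p
     - (real DIM('a) - 1) * snd p * dderiv u (0, 1) p"

text \<open>Ideal boundary of H^n: None is the point at infinity, Some x is the point (x,0)
of the boundary hyperplane. The cone topology on H^n \<union> ideal boundary agrees with the
topology of the closed half-space plus one point at infinity.  The ideal boundary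
of a set is the set of ideal points in its closure.\<close>
definition ideal_boundary :: "('a::euclidean_space \<times> real) set \<Rightarrow> 'a option set" where
  "ideal_boundary \<Omega> =
     {Some x | x. (x, 0) \<in> closure \<Omega>} \<union> {None | _::unit. \<not> bounded \<Omega>}"

definition hyp_closure :: "('a::euclidean_space \<times> real) set \<Rightarrow> ('a \<times> real) set" where
  "hyp_closure \<Omega> = closure \<Omega> \<inter> hyp_space"

definition hyp_frontier :: "('a::euclidean_space \<times> real) set \<Rightarrow> ('a \<times> real) set" where
  "hyp_frontier \<Omega> = hyp_closure \<Omega> - \<Omega>"

end

theory Submission
  imports Defs "HOL-Real_Asymp.Real_Asymp"
begin

text \<open>Let \<open>m = n - 1\<close> and let \<open>Q\<close> be the hyperbolic sine of the signed distance to a geodesic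
  hyperplane. Since \<open>|\<nabla>Q|\<^sup>2 = 1 + Q\<^sup>2\<close> and \<open>\<Delta>Q = (m + 1) Q\<close>, the function
  \<open>W = 2 Q\<^bsup>-m/2\<^esup> - Q\<^bsup>-m/2-1\<^esup>\<close> satisfies \<open>-\<Delta>W > (m\<^sup>2/4) W\<close> where \<open>Q\<close> is large. Take a hyperplane
  that cuts \<open>p\<close> off: the part of the closure of the domain where \<open>Q \<ge> q\<^sub>0\<close> is then compact, and the
  quotient \<open>u/W\<close> has no positive interior maximum there, so \<open>|u| \<le> sup |u| W / W(q\<^sub>0)\<close>.
  As the hyperplane shrinks to \<open>p\<close>, \<open>Q\<close> tends to infinity and \<open>W\<close> to 0 at every fixed point.\<close>

section \<open>One-variable calculus and restriction to lines\<close>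

text \<open>If \<open>c\<close> were positive, \<open>f'\<close> would be positive just to the right
  of its zero at 0, and the mean value theorem would give a value of \<open>f\<close> above
  \<open>f 0\<close>.\<close>

lemma second_derivative_test_max:
  fixes f f' :: "real \<Rightarrow> real"
  assumes d: "0 < d"
    and f: "\<And>s. \<bar>s\<bar> < d \<Longrightarrow> (f has_real_derivative f' s) (at s)"
    and f': "(f' has_real_derivative c) (at 0)"
    and le: "\<And>s. \<bar>s\<bar> < d \<Longrightarrow> f s \<le> f 0"
  shows "f' 0 = 0" and "c \<le> 0"
proof -
  show f0: "f' 0 = 0"
    by (rule DERIV_local_max[OF f[of 0] d]) (use d le in auto)
  show "c \<le> 0"
  proof (rule ccontr)
    assume "\<not> c \<le> 0"
    then obtain e where e: "e > 0" "\<And>h. 0 < h \<Longrightarrow> h < e \<Longrightarrow> f' 0 < f' (0 + h)"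
      using DERIV_pos_inc_right[OF f'] by force
    define h where "h = min d e / 2"
    have h: "0 < h" "h < d" "h < e"
      using d e(1) by (auto simp: h_def)
    obtain s where s: "0 < s" "s < h" "f h - f 0 = (h - 0) * f' s"
      using MVT2[of 0 h f f'] h f by force
    have "f' s > 0" using e(2)[of s] s h f0 by simp
    then have "f h > f 0" using s h by (smt (verit) mult_pos_pos)
    then show False using le[of h] h by simp
  qed
qed

text \<open>This reduces derivatives of \<open>u\<close> to the one-variable test; applied to
  \<open>dderiv u b\<close> in place of \<open>u\<close>, it also supplies the second derivative
  along the line.\<close>

lemma has_real_derivative_along_line:
  fixes u :: "'b::euclidean_space \<Rightarrow> real"
  assumes "u differentiable at (z + s *\<^sub>R b)"
  shows "((\<lambda>s. u (z + s *\<^sub>R b)) has_real_derivative dderiv u b (z + s *\<^sub>R b)) (at s)"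
proof -
  let ?D = "frechet_derivative u (at (z + s *\<^sub>R b))"
  have D: "(u has_derivative ?D) (at (z + s *\<^sub>R b))"
    using assms by (simp add: frechet_derivative_works)
  have "((\<lambda>s. z + s *\<^sub>R b) has_derivative (\<lambda>h. h *\<^sub>R b)) (at s)"
    by (auto intro!: derivative_eq_intros)
  from has_derivative_compose[OF this D]
  have "((\<lambda>s. u (z + s *\<^sub>R b)) has_derivative (\<lambda>h. ?D (h *\<^sub>R b))) (at s)" .
  moreover have "?D (h *\<^sub>R b) = dderiv u b (z + s *\<^sub>R b) * h" for h
    using linear_cmul[OF has_derivative_linear[OF D], of h b] by (simp add: dderiv_def)
  ultimately show ?thesis by (simp add: has_field_derivative_def)
qed

section \<open>The one-variable barrier and its differential inequality\<close>

text \<open>The barrier \<open>W\<close> as a function of \<open>Q\<close>, with \<open>a = m/2\<close>.\<close>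

definition profile :: "real \<Rightarrow> real \<Rightarrow> real" where
  "profile a q = q powr (- a) * (2 - 1 / q)"

definition profile' :: "real \<Rightarrow> real \<Rightarrow> real" where
  "profile' a q = q powr (- a) * (- 2 * a / q + (a + 1) / q\<^sup>2)"

definition profile'' :: "real \<Rightarrow> real \<Rightarrow> real" where
  "profile'' a q = q powr (- a) * (2 * a * (a + 1) / q\<^sup>2 - (a + 1) * (a + 2) / q ^ 3)"

text \<open>Keeping \<open>q powr (- a)\<close> as a common factor reduces both derivatives of the
  barrier to identities between rational functions of \<open>q\<close>.\<close>

lemma powr_minus_mult_derivative:
  fixes q :: real
  assumes q: "0 < q" and f: "(f has_real_derivative D) (at q)"
  shows "((\<lambda>q. q powr (- a) * f q) has_real_derivative q powr (- a) * (D - a * f q / q)) (at q)"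
proof -
  have "((\<lambda>q. q powr (- a)) has_real_derivative - a * (q powr (- a) / q)) (at q)"
    using has_real_derivative_powr[OF q, of "- a"] q by (simp add: powr_diff)
  from DERIV_mult[OF this f] show ?thesis by (simp add: algebra_simps)
qed

lemma profile_derivative:
  assumes "0 < q"
  shows "(profile a has_real_derivative profile' a q) (at q)"
proof -
  have "((\<lambda>q. 2 - 1 / q) has_real_derivative 1 / q\<^sup>2) (at q)"
    using assms by (auto intro!: derivative_eq_intros simp: power2_eq_square)
  moreover have "1 / q\<^sup>2 - a * (2 - 1 / q) / q = - 2 * a / q + (a + 1) / q\<^sup>2"
    using assms by (simp add: field_simps power2_eq_square)
  ultimately show ?thesis
    using powr_minus_mult_derivative[OF assms, of "\<lambda>q. 2 - 1 / q" "1 / q\<^sup>2" a]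
    by (simp only: profile_def[abs_def] profile'_def)
qed

lemma profile'_derivative:
  assumes "0 < q"
  shows "(profile' a has_real_derivative profile'' a q) (at q)"
proof -
  have "((\<lambda>q. - 2 * a / q + (a + 1) / q\<^sup>2) has_real_derivative
      2 * a / q\<^sup>2 - 2 * (a + 1) / q ^ 3) (at q)"
    using assms
    by (auto intro!: derivative_eq_intros simp: field_simps power2_eq_square power3_eq_cube)
  moreover have "2 * a / q\<^sup>2 - 2 * (a + 1) / q ^ 3 - a * (- 2 * a / q + (a + 1) / q\<^sup>2) / q
      = 2 * a * (a + 1) / q\<^sup>2 - (a + 1) * (a + 2) / q ^ 3"
    using assms by (simp add: field_simps power2_eq_square power3_eq_cube)
  ultimately show ?thesis
    using powr_minus_mult_derivative[OF assms, of "\<lambda>q. - 2 * a / q + (a + 1) / q\<^sup>2"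
        "2 * a / q\<^sup>2 - 2 * (a + 1) / q ^ 3" a]
    by (simp only: profile''_def profile'_def[abs_def])
qed

lemma profile_pos: "1 \<le> q \<Longrightarrow> 0 < profile a q"
  by (auto simp: profile_def field_simps)

lemma profile_tendsto_0:
  assumes "0 < a"
  shows "(profile a \<longlongrightarrow> 0) at_top"
proof -
  have "((\<lambda>q::real. q powr (- a) * (2 - 1 / q)) \<longlongrightarrow> 0 * (2 - 0)) at_top"
    using assms by (intro tendsto_intros tendsto_neg_powr filterlim_ident
        tendsto_divide_0[OF tendsto_const] filterlim_at_top_imp_at_infinity) auto
  then show ?thesis by (simp add: profile_def[abs_def])
qed

text \<open>The left side is the hyperbolic Laplacian of \<open>profile a\<close> composed with Q,
  plus \<open>a\<^sup>2\<close> times that function. The exponent -a is the double root of the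
  indicial equation, so q^(-a) contributes only the error a(a+1) q^(-a-2). The correction -q^(-a-1)
  contributes -q^(-a-1) - (a+1)(a+2) q^(-a-3), whose first term beats twice that error exactly when
  q > 2a(a+1).\<close>

lemma profile_strict_supersolution:
  assumes a: "0 < a" and q: "2 * a * (a + 1) < q"
  shows "profile'' a q * (1 + q\<^sup>2) + (2 * a + 1) * q * profile' a q + a\<^sup>2 * profile a q < 0"
proof -
  have q0: "0 < q" using assms by (smt (verit) mult_pos_pos)
  have "profile'' a q * (1 + q\<^sup>2) + (2 * a + 1) * q * profile' a q + a\<^sup>2 * profile a q
      = q powr (- a) * ((2 * a * (a + 1) / q\<^sup>2 - (a + 1) * (a + 2) / q ^ 3) * (1 + q\<^sup>2)
          + (2 * a + 1) * q * (- 2 * a / q + (a + 1) / q\<^sup>2) + a\<^sup>2 * (2 - 1 / q))"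
    unfolding profile_def profile'_def profile''_def by (simp only: algebra_simps)
  also have "\<dots> = q powr (- a) * ((2 * a * (a + 1) - q) / q\<^sup>2 - (a + 1) * (a + 2) / q ^ 3)"
  proof -
    have "(2 * a * (a + 1) / q\<^sup>2 - (a + 1) * (a + 2) / q ^ 3) * (1 + q\<^sup>2)
          + (2 * a + 1) * q * (- 2 * a / q + (a + 1) / q\<^sup>2) + a\<^sup>2 * (2 - 1 / q)
      = (2 * a * (a + 1) - q) / q\<^sup>2 - (a + 1) * (a + 2) / q ^ 3"
      using q0 by (simp add: divide_simps) algebra
    then show ?thesis by simp
  qed
  also have "\<dots> < 0"
  proof -
    have "(2 * a * (a + 1) - q) / q\<^sup>2 < 0"
      using q q0 by (simp add: divide_neg_pos)
    moreover have "(a + 1) * (a + 2) / q ^ 3 > 0"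
      using a q0 by simp
    ultimately show ?thesis using q0 by (intro mult_pos_neg) auto
  qed
  finally show ?thesis .
qed

section \<open>Comparison of \<open>u\<close> with the barrier at a touching point\<close>

text \<open>For \<open>4AB = -1\<close> this is the hyperbolic sine of the signed distance to the geodesic
  hyperplane where \<open>A(|x - y|\<^sup>2 + t\<^sup>2) + B = 0\<close>.\<close>

definition hyperplane_height :: "real \<Rightarrow> real \<Rightarrow> 'a \<Rightarrow> 'a::euclidean_space \<times> real \<Rightarrow> real" where
  "hyperplane_height A B y z = (A * ((norm (fst z - y))\<^sup>2 + (snd z)\<^sup>2) + B) / snd z"

text \<open>Along the line the difference of the two sides of \<open>le\<close> has a maximum, equal
  to 0, at \<open>s = 0\<close>, so the second derivative test applies. Here \<open>\<phi>\<close>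
  is the height restricted to the line, and the factor \<open>c\<close> lets one argument treat both
  \<open>u\<close> and \<open>-u\<close>.\<close>

lemma touching_along_line:
  fixes u :: "'b::euclidean_space \<Rightarrow> real"
  assumes S: "open S" "z \<in> S" and u: "C2_on S u" and b: "b \<in> Basis"
    and \<phi>: "\<And>s. z + s *\<^sub>R b \<in> S \<Longrightarrow> 0 < \<phi> s \<and> (\<phi> has_real_derivative \<phi>' s) (at s)"
    and \<phi>': "(\<phi>' has_real_derivative \<phi>'') (at 0)"
    and le: "\<And>s. z + s *\<^sub>R b \<in> S \<Longrightarrow> c * u (z + s *\<^sub>R b) \<le> k * profile a (\<phi> s)"
    and eq: "c * u z = k * profile a (\<phi> 0)"
  shows "c * dderiv u b z = k * (profile' a (\<phi> 0) * \<phi>' 0)"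
    and "c * dderiv (dderiv u b) b z
          \<le> k * (profile'' a (\<phi> 0) * (\<phi>' 0)\<^sup>2 + profile' a (\<phi> 0) * \<phi>'')"
proof -
  obtain d where d: "d > 0" "ball z d \<subseteq> S"
    using S by (meson open_contains_ball)
  have inS: "z + s *\<^sub>R b \<in> S" if "\<bar>s\<bar> < d" for s
    using that d b by (auto simp: dist_norm intro!: subsetD[OF d(2)])
  let ?f = "\<lambda>s. c * u (z + s *\<^sub>R b) - k * profile a (\<phi> s)"
  let ?f' = "\<lambda>s. c * dderiv u b (z + s *\<^sub>R b) - k * (profile' a (\<phi> s) * \<phi>' s)"
  let ?c = "c * dderiv (dderiv u b) b z
     - k * (profile'' a (\<phi> 0) * (\<phi>' 0)\<^sup>2 + profile' a (\<phi> 0) * \<phi>'')"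
  have z0: "z + 0 *\<^sub>R b \<in> S" using S by simp
  have f: "(?f has_real_derivative ?f' s) (at s)" if "\<bar>s\<bar> < d" for s
    using u inS[OF that] \<phi>[OF inS[OF that]]
    by (intro DERIV_diff DERIV_cmult has_real_derivative_along_line
        DERIV_chain2[where f="profile a"] profile_derivative) (auto simp: C2_on_def)
  have "((\<lambda>s. dderiv u b (z + s *\<^sub>R b)) has_real_derivative dderiv (dderiv u b) b z) (at 0)"
    using has_real_derivative_along_line[of "dderiv u b" z 0 b] u S b by (simp add: C2_on_def)
  moreover have "((\<lambda>s. profile' a (\<phi> s)) has_real_derivative profile'' a (\<phi> 0) * \<phi>' 0) (at 0)"
    using \<phi>[OF z0] by (intro DERIV_chain2[where f="profile' a"] profile'_derivative) auto
  ultimately have f': "(?f' has_real_derivative ?c) (at 0)"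
    using \<phi>' by (auto intro!: derivative_eq_intros simp: power2_eq_square algebra_simps)
  have fle: "?f s \<le> ?f 0" if "\<bar>s\<bar> < d" for s
    using le[OF inS[OF that]] eq by simp
  from second_derivative_test_max[OF d(1) f f' fle]
  show "c * dderiv u b z = k * (profile' a (\<phi> 0) * \<phi>' 0)"
    and "c * dderiv (dderiv u b) b z
          \<le> k * (profile'' a (\<phi> 0) * (\<phi>' 0)\<^sup>2 + profile' a (\<phi> 0) * \<phi>'')"
    by simp_all
qed

lemma eucl_laplacian_prod:
  fixes u :: "'a::euclidean_space \<times> real \<Rightarrow> real"
  shows "eucl_laplacian u z = (\<Sum>b\<in>Basis. dderiv (dderiv u (b, 0)) (b, 0) z)
           + dderiv (dderiv u (0, 1)) (0, 1) z"
proof -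
  have "inj_on (\<lambda>b::'a. (b, 0::real)) Basis" by (auto intro: inj_onI)
  then show ?thesis
    unfolding eucl_laplacian_def Basis_prod_def
    by (subst sum.union_disjoint) (auto simp: sum.reindex)
qed

text \<open>Touching from below compares the pure second derivatives in every coordinate direction
  and equates the first derivatives, in particular the vertical one occurring in
  \<open>hyp_laplacian\<close>. Hence the Laplacian of \<open>c * u\<close> at \<open>z\<close> is
  at most that of the barrier, which is a strict supersolution.\<close>

lemma touching_laplacian_less:
  fixes u :: "'a::euclidean_space \<times> real \<Rightarrow> real" and y :: 'a
  defines "a \<equiv> real DIM('a) / 2"
  assumes S: "open S" "z \<in> S" "S \<subseteq> hyp_space" and u: "C2_on S u"
    and AB: "4 * A * B = - 1"
    and Q: "\<And>w. w \<in> S \<Longrightarrow> 2 * a * (a + 1) < hyperplane_height A B y w"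
    and k: "0 < k"
    and le: "\<And>w. w \<in> S \<Longrightarrow> c * u w \<le> k * profile a (hyperplane_height A B y w)"
    and eq: "c * u z = k * profile a (hyperplane_height A B y z)"
  shows "c * hyp_laplacian u z < - (a\<^sup>2 * (c * u z))"
proof -
  obtain x t where z: "z = (x, t)" by (cases z)
  have t: "0 < t" using S by (auto simp: hyp_space_def z)
  have a: "0 < a" by (simp add: a_def)
  define q where "q = hyperplane_height A B y z"
  \<comment> \<open>On the vertical line through \<open>z\<close> the horizontal distance to
    \<open>y\<close> is fixed, so there the height is A t + D/t with this constant
    \<open>D\<close>.\<close>
  define D where "D = A * (norm (x - y))\<^sup>2 + B"
  have Q0: "0 < hyperplane_height A B y w" if "w \<in> S" for w
    using Q[OF that] a by (smt (verit) mult_pos_pos)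
  have q_eq: "q = A * t + D / t"
    using t by (simp add: q_def D_def z hyperplane_height_def field_simps power2_eq_square)
  have horiz: "c * dderiv (dderiv u (b, 0)) (b, 0) z
      \<le> k * (profile'' a q * (2 * A * ((x - y) \<bullet> b) / t)\<^sup>2 + profile' a q * (2 * A / t))"
    if b: "b \<in> Basis" for b
  proof -
    define \<phi> where "\<phi> = (\<lambda>s. (A * ((norm (x - y))\<^sup>2 + 2 * s * ((x - y) \<bullet> b) + s\<^sup>2 + t\<^sup>2) + B) / t)"
    have \<phi>: "hyperplane_height A B y (z + s *\<^sub>R (b, 0)) = \<phi> s" for s
    proof -
      have "(norm (x + s *\<^sub>R b - y))\<^sup>2 = (norm (x - y))\<^sup>2 + 2 * s * ((x - y) \<bullet> b) + s\<^sup>2"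
        using b unfolding power2_norm_eq_inner
        by (simp add: inner_simps inner_commute algebra_simps power2_eq_square)
      then show ?thesis by (simp add: hyperplane_height_def z \<phi>_def)
    qed
    have \<phi>0: "\<phi> 0 = q" using \<phi>[of 0] by (simp add: q_def zero_prod_def[symmetric])
    have "c * dderiv (dderiv u (b, 0)) (b, 0) z
      \<le> k * (profile'' a (\<phi> 0) * ((\<lambda>s. 2 * A * ((x - y) \<bullet> b + s) / t) 0)\<^sup>2
            + profile' a (\<phi> 0) * (2 * A / t))"
    proof (rule touching_along_line(2)[OF S(1,2) u])
      show "(b, 0) \<in> Basis" using b by (simp add: Basis_prod_def)
      show "0 < \<phi> s \<and> (\<phi> has_real_derivative 2 * A * ((x - y) \<bullet> b + s) / t) (at s)"
        if "z + s *\<^sub>R (b, 0) \<in> S" for s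
        using Q0[OF that] t unfolding \<phi>
        by (auto simp: \<phi>_def field_simps intro!: derivative_eq_intros)
      show "((\<lambda>s. 2 * A * ((x - y) \<bullet> b + s) / t) has_real_derivative 2 * A / t) (at 0)"
        using t by (auto intro!: derivative_eq_intros)
      show "c * u (z + s *\<^sub>R (b, 0)) \<le> k * profile a (\<phi> s)" if "z + s *\<^sub>R (b, 0) \<in> S" for s
        using le[OF that] by (simp only: \<phi>)
      show "c * u z = k * profile a (\<phi> 0)" using eq by (simp add: \<phi>0 q_def)
    qed
    then show ?thesis by (simp add: \<phi>0)
  qed
  define \<phi> where "\<phi> = (\<lambda>s. A * (t + s) + D / (t + s))"
  have S_pos: "t + s > 0" if "z + s *\<^sub>R (0, 1) \<in> S" for s
    using subsetD[OF S(3) that] by (simp add: hyp_space_def z)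
  have \<phi>: "hyperplane_height A B y (z + s *\<^sub>R (0, 1)) = \<phi> s" if "z + s *\<^sub>R (0, 1) \<in> S" for s
    using S_pos[OF that]
    by (simp add: hyperplane_height_def z \<phi>_def D_def field_simps power2_eq_square)
  have \<phi>0: "\<phi> 0 = q" by (simp add: \<phi>_def q_eq)
  have e: "(0, 1) \<in> (Basis :: ('a \<times> real) set)" by (simp add: Basis_prod_def)
  have \<phi>_deriv: "0 < \<phi> s \<and> (\<phi> has_real_derivative A - D / (t + s)\<^sup>2) (at s)"
    if "z + s *\<^sub>R (0, 1) \<in> S" for s
    using Q0[OF that] S_pos[OF that] unfolding \<phi>[OF that]
    by (auto simp: \<phi>_def power2_eq_square intro!: derivative_eq_intros)
  have \<phi>_deriv2: "((\<lambda>s. A - D / (t + s)\<^sup>2) has_real_derivative 2 * D / t ^ 3) (at 0)"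
    using t by (auto intro!: derivative_eq_intros simp: field_simps power_numeral_reduce)
  have \<phi>_le: "c * u (z + s *\<^sub>R (0, 1)) \<le> k * profile a (\<phi> s)" if "z + s *\<^sub>R (0, 1) \<in> S" for s
    using le[OF that] by (simp only: \<phi>[OF that])
  have \<phi>_eq: "c * u z = k * profile a (\<phi> 0)" using eq by (simp add: \<phi>0 q_def)
  note vert = touching_along_line[OF S(1,2) u e \<phi>_deriv \<phi>_deriv2 \<phi>_le \<phi>_eq]
  have norm_sum: "(\<Sum>b\<in>Basis. (2 * A * ((x - y) \<bullet> b) / t)\<^sup>2) = 4 * A\<^sup>2 * (norm (x - y))\<^sup>2 / t\<^sup>2"
    unfolding power2_norm_eq_inner
    by (subst euclidean_inner)
      (simp add: sum_distrib_left sum_divide_distrib power_mult_distrib power_divide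
        power2_eq_square[of "_ \<bullet> _"] mult.assoc)
  have "c * eucl_laplacian u z = (\<Sum>b\<in>Basis. c * dderiv (dderiv u (b, 0)) (b, 0) z)
      + c * dderiv (dderiv u (0, 1)) (0, 1) z"
    by (simp add: eucl_laplacian_prod distrib_left sum_distrib_left)
  also have "\<dots> \<le>
      (\<Sum>b\<in>Basis. k * (profile'' a q * (2 * A * ((x - y) \<bullet> b) / t)\<^sup>2 + profile' a q * (2 * A / t)))
      + k * (profile'' a q * (A - D / t\<^sup>2)\<^sup>2 + profile' a q * (2 * D / t ^ 3))"
    using vert(2) by (intro add_mono sum_mono horiz) (simp_all add: \<phi>0)
  also have "\<dots> = k * (profile'' a q * (4 * A\<^sup>2 * (norm (x - y))\<^sup>2 / t\<^sup>2)
        + 2 * a * (profile' a q * (2 * A / t)))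
      + k * (profile'' a q * (A - D / t\<^sup>2)\<^sup>2 + profile' a q * (2 * D / t ^ 3))"
    by (simp add: sum_distrib_left[symmetric] sum.distrib norm_sum a_def)
  finally have lap: "t\<^sup>2 * (c * eucl_laplacian u z) \<le> t\<^sup>2 * \<dots>"
    by (rule mult_left_mono) simp
  \<comment> \<open>This is |grad Q|^2 = 1 + Q^2 in the hyperbolic metric: the difference of squares
    is 4AD, and \<open>4 * A * B = - 1\<close> turns it into 4 A^2 |x - y|^2 - 1.\<close>
  have quad: "4 * A\<^sup>2 * (norm (x - y))\<^sup>2 + (A * t - D / t)\<^sup>2 = 1 + q\<^sup>2"
  proof -
    have "q\<^sup>2 - (A * t - D / t)\<^sup>2 = 4 * A * D"
      using t by (simp add: q_eq power2_eq_square field_simps)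
    then show ?thesis using AB by (simp add: D_def power2_eq_square algebra_simps)
  qed
  have "c * hyp_laplacian u z = t\<^sup>2 * (c * eucl_laplacian u z) - (2 * a - 1) * t * (c * dderiv u (0, 1) z)"
    by (simp add: hyp_laplacian_def z a_def algebra_simps)
  also have "\<dots> \<le> k * (profile'' a q * (4 * A\<^sup>2 * (norm (x - y))\<^sup>2 + (A * t - D / t)\<^sup>2)
      + profile' a q * ((2 * a + 1) * (A * t + D / t)))"
  proof -
    \<comment> \<open>The coefficients of \<open>profile' a q\<close> add up to (2a+1)(A t + D/t),
      which is the identity Delta Q = (m+1) Q.\<close>
    have 1: "t\<^sup>2 * (k * (profile'' a q * (4 * A\<^sup>2 * (norm (x - y))\<^sup>2 / t\<^sup>2)
        + 2 * a * (profile' a q * (2 * A / t)))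
      + k * (profile'' a q * (A - D / t\<^sup>2)\<^sup>2 + profile' a q * (2 * D / t ^ 3)))
      - (2 * a - 1) * t * (k * (profile' a q * (A - D / t\<^sup>2)))
      = k * (profile'' a q * (4 * A\<^sup>2 * (norm (x - y))\<^sup>2 + (A * t - D / t)\<^sup>2)
      + profile' a q * ((2 * a + 1) * (A * t + D / t)))"
      using t by (simp add: field_simps power_numeral_reduce)
    show ?thesis using lap vert(1) 1 by (simp add: \<phi>0)
  qed
  also have "\<dots> = k * (profile'' a q * (1 + q\<^sup>2) + (2 * a + 1) * q * profile' a q)"
    unfolding quad q_eq[symmetric] by (simp add: algebra_simps)
  also have "\<dots> < k * (- (a\<^sup>2 * profile a q))"
    using profile_strict_supersolution[OF a Q[OF S(2)]] k
    by (intro mult_strict_left_mono) (auto simp: q_def)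
  also have "\<dots> = - (a\<^sup>2 * (c * u z))"
    using eq by (simp add: q_def)
  finally show ?thesis .
qed

section \<open>The maximum principle on the region cut off by a hyperplane\<close>

lemma C2_on_subset:
  assumes "C2_on S u" "T \<subseteq> S"
  shows "C2_on T u"
  using assms unfolding C2_on_def by (meson continuous_on_subset subsetD)

text \<open>If the bound failed, the quotient of \<open>c * u\<close> by the barrier would have a
  maximum above \<open>M / profile a q0\<close> on the compact region of height at least
  \<open>q0\<close>. Such a maximum is neither on the frontier, where \<open>u\<close> vanishes, nor
  at height \<open>q0\<close>, where \<open>M\<close> bounds \<open>c * u\<close>. At an interior
  maximum, a multiple of the barrier touches \<open>c * u\<close> from above, which contradicts the
  equation since \<open>lam \<le> a\<^sup>2\<close>.\<close>

lemma bounded_le_profile: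
  fixes u :: "'a::euclidean_space \<times> real \<Rightarrow> real" and y :: 'a
  defines "a \<equiv> real DIM('a) / 2"
  assumes \<Omega>: "open \<Omega>" "\<Omega> \<subseteq> hyp_space" and lam: "lam \<le> a\<^sup>2"
    and cont: "continuous_on (hyp_closure \<Omega>) u" and u: "C2_on \<Omega> u"
    and eq: "\<And>z. z \<in> \<Omega> \<Longrightarrow> - hyp_laplacian u z = lam * u z"
    and zero: "\<And>z. z \<in> hyp_frontier \<Omega> \<Longrightarrow> u z = 0"
    and M: "0 \<le> M" "\<And>z. z \<in> hyp_closure \<Omega> \<Longrightarrow> c * u z \<le> M"
    and AB: "4 * A * B = - 1" and q0: "1 \<le> q0" "2 * a * (a + 1) < q0"
    and K: "bounded {z \<in> closure \<Omega>. q0 * snd z \<le> A * ((norm (fst z - y))\<^sup>2 + (snd z)\<^sup>2) + B}"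
      "{z \<in> closure \<Omega>. q0 * snd z \<le> A * ((norm (fst z - y))\<^sup>2 + (snd z)\<^sup>2) + B} \<subseteq> hyp_space"
    and z0: "z0 \<in> \<Omega>" "q0 \<le> hyperplane_height A B y z0"
  shows "c * u z0 \<le> M / profile a q0 * profile a (hyperplane_height A B y z0)"
proof (rule ccontr)
  let ?N = "\<lambda>z. A * ((norm (fst z - y))\<^sup>2 + (snd z)\<^sup>2) + B"
  let ?Q = "hyperplane_height A B y"
  let ?K = "{z \<in> closure \<Omega>. q0 * snd z \<le> ?N z}"
  let ?r = "\<lambda>z. c * u z / profile a (?Q z)"
  assume neg: "\<not> ?thesis"
  \<comment> \<open>With the denominator \<open>snd z\<close> cleared, the condition on the height
    is closed in the whole Euclidean space, including at \<open>snd z = 0\<close>; together with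
    \<open>K\<close> this gives compactness.\<close>
  have "closed {z. q0 * snd z \<le> ?N z}"
    by (intro closed_Collect_le continuous_intros)
  then have "closed ?K" by (simp add: closed_Int Collect_conj_eq)
  with K have "compact ?K" by (simp add: compact_eq_bounded_closed)
  have K_pos: "0 < snd z" if "z \<in> ?K" for z using K(2) that by (auto simp: hyp_space_def)
  have K_Q: "q0 \<le> ?Q z" if "z \<in> ?K" for z
    using that K_pos[OF that] by (simp add: hyperplane_height_def pos_le_divide_eq)
  have K_cl: "?K \<subseteq> hyp_closure \<Omega>" using K(2) by (auto simp: hyp_closure_def)
  have prof_pos: "0 < profile a (?Q z)" if "z \<in> ?K" for z
    using K_Q[OF that] q0(1) by (intro profile_pos) simp
  have cont_Q: "continuous_on ?K ?Q"
    unfolding hyperplane_height_def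
    by (intro continuous_intros ballI less_imp_neq[OF K_pos, symmetric])
  have cont_prof: "continuous_on {1..} (profile a)"
    by (auto intro!: DERIV_continuous_on[where D="profile' a"] has_field_derivative_at_within
        profile_derivative)
  have "continuous_on ?K (\<lambda>z. profile a (?Q z))"
  proof (rule continuous_on_compose2[OF cont_prof cont_Q])
    show "?Q ` ?K \<subseteq> {1..}"
    proof (rule image_subsetI)
      fix z assume "z \<in> ?K"
      from K_Q[OF this] q0(1) show "?Q z \<in> {1..}" by simp
    qed
  qed
  then have cr: "continuous_on ?K ?r"
    by (intro continuous_intros continuous_on_subset[OF cont K_cl] ballI
        less_imp_neq[OF prof_pos, symmetric])
  have z0K: "z0 \<in> ?K"
  proof -
    have "0 < snd z0" using z0(1) \<Omega>(2) by (auto simp: hyp_space_def)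
    then show ?thesis
      using z0 closure_subset by (auto simp: hyperplane_height_def pos_le_divide_eq)
  qed
  then obtain z1 where z1: "z1 \<in> ?K" "\<And>z. z \<in> ?K \<Longrightarrow> ?r z \<le> ?r z1"
    using continuous_attains_sup[OF \<open>compact ?K\<close> _ cr] by blast
  define k where "k = ?r z1"
  have pq0: "0 < profile a q0" using profile_pos q0(1) .
  have "M / profile a q0 < ?r z0"
    using neg prof_pos[OF z0K] by (simp add: pos_less_divide_eq not_le)
  then have kM: "M / profile a q0 < k"
    using z1(2)[OF z0K] by (simp add: k_def)
  moreover have "0 \<le> M / profile a q0" using M(1) pq0 by simp
  ultimately have k: "0 < k" by linarith
  have uk: "c * u z1 = k * profile a (?Q z1)"
    using prof_pos[OF z1(1)] by (simp add: k_def)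
  have z1\<Omega>: "z1 \<in> \<Omega>"
  proof (rule ccontr)
    assume "z1 \<notin> \<Omega>"
    then have "u z1 = 0" using z1(1) K_cl by (intro zero) (auto simp: hyp_frontier_def)
    then show False using k by (simp add: k_def)
  qed
  have "?Q z1 \<noteq> q0"
  proof
    assume "?Q z1 = q0"
    then have "M < c * u z1" using kM pq0 by (simp add: uk pos_divide_less_eq)
    then show False using M(2)[of z1] z1(1) K_cl by auto
  qed
  then have Q1: "q0 < ?Q z1" using K_Q[OF z1(1)] by simp
  \<comment> \<open>The strict inequality gives an open neighbourhood of \<open>z1\<close> inside
    \<open>?K\<close>, on which the maximality of \<open>k\<close> is the touching
    condition.\<close>
  define S where "S = {z \<in> \<Omega>. q0 * snd z < ?N z}"
  have "open {z. q0 * snd z < ?N z}"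
    by (intro open_Collect_less continuous_intros)
  then have "open S" using \<Omega>(1) by (simp add: S_def open_Int Collect_conj_eq)
  have z1S: "z1 \<in> S"
    using z1\<Omega> Q1 K_pos[OF z1(1)] by (simp add: S_def hyperplane_height_def pos_less_divide_eq)
  have SK: "S \<subseteq> ?K" using closure_subset by (auto simp: S_def)
  have "c * hyp_laplacian u z1 < - (a\<^sup>2 * (c * u z1))"
    unfolding a_def
  proof (rule touching_laplacian_less[OF \<open>open S\<close> z1S])
    have "S \<subseteq> \<Omega>" by (auto simp: S_def)
    then show "S \<subseteq> hyp_space" "C2_on S u"
      using \<Omega>(2) C2_on_subset[OF u] by auto
    show "4 * A * B = - 1" by (fact AB)
    show "0 < k" by (fact k)
    show "c * u z1 = k * profile (real DIM('a) / 2) (?Q z1)"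
      using uk by (simp add: a_def)
    fix w assume "w \<in> S"
    then have w: "w \<in> ?K" using SK by blast
    show "2 * (real DIM('a) / 2) * (real DIM('a) / 2 + 1) < ?Q w"
      using K_Q[OF w] q0(2) unfolding a_def by linarith
    show "c * u w \<le> k * profile (real DIM('a) / 2) (?Q w)"
      using z1(2)[OF w] prof_pos[OF w] by (simp add: k_def a_def pos_divide_le_eq)
  qed
  \<comment> \<open>Replacing \<open>a\<^sup>2\<close> by \<open>lam\<close> uses that
    \<open>c * u z1\<close> is positive.\<close>
  also have "\<dots> \<le> - (lam * (c * u z1))"
    using lam k prof_pos[OF z1(1)] by (simp add: uk mult_right_mono)
  also have "\<dots> = c * hyp_laplacian u z1"
  proof -
    have "hyp_laplacian u z1 = - (lam * u z1)" using eq[OF z1\<Omega>] by simp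
    then show ?thesis by simp
  qed
  finally show False by simp
qed

section \<open>Geodesic hyperplanes shrinking to the ideal point\<close>

text \<open>The hyperplanes are hemispheres centred on the boundary hyperplane, with Q positive on
  the side away from \<open>p\<close>. As \<open>p\<close> is the only ideal point of the domain,
  its closure on that side is bounded and stays off the boundary hyperplane.\<close>

lemma hyperplane_heights_tendsto:
  fixes \<Omega> :: "('a::euclidean_space \<times> real) set"
  assumes \<Omega>: "\<Omega> \<subseteq> hyp_space" and p: "ideal_boundary \<Omega> = {p}" and z0: "z0 \<in> \<Omega>"
  obtains A B :: "real \<Rightarrow> real" and y where
    "\<And>R. 0 < R \<Longrightarrow> 4 * A R * B R = - 1"
    "\<And>R q. 0 < R \<Longrightarrow> 0 < q \<Longrightarrow>
       bounded {z \<in> closure \<Omega>. q * snd z \<le> A R * ((norm (fst z - y))\<^sup>2 + (snd z)\<^sup>2) + B R}"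
    "\<And>R q. 0 < R \<Longrightarrow> 0 < q \<Longrightarrow>
       {z \<in> closure \<Omega>. q * snd z \<le> A R * ((norm (fst z - y))\<^sup>2 + (snd z)\<^sup>2) + B R} \<subseteq> hyp_space"
    "filterlim (\<lambda>R. hyperplane_height (A R) (B R) y z0) at_top at_top"
proof -
  have t0: "0 < snd z0" using z0 \<Omega> by (auto simp: hyp_space_def)
  have cl: "0 \<le> snd z" if "z \<in> closure \<Omega>" for z
  proof -
    have "closed {z :: 'a \<times> real. 0 \<le> snd z}" by (intro closed_Collect_le continuous_intros)
    moreover have "\<Omega> \<subseteq> {z. 0 \<le> snd z}" using \<Omega> by (auto simp: hyp_space_def)
    ultimately show ?thesis using closure_minimal that by blast
  qed
  have norm_z: "(norm z)\<^sup>2 = (norm (fst z))\<^sup>2 + (snd z)\<^sup>2" for z :: "'a \<times> real"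
    by (simp add: norm_prod_def)
  show ?thesis
  proof (cases p)
    case None
    then have nz: "(x, 0) \<notin> closure \<Omega>" for x
      using p by (auto simp: ideal_boundary_def set_eq_iff)
    \<comment> \<open>For \<open>p\<close> at infinity: the hemisphere of radius \<open>R\<close>
      about the origin, with Q = (R^2 - |z|^2) / (2 R t) positive inside.\<close>
    define A B :: "real \<Rightarrow> real" where "A = (\<lambda>R. - 1 / (2 * R))" and "B = (\<lambda>R. R / 2)"
    show ?thesis
    proof (rule that[of A B 0])
      fix R q :: real assume R: "0 < R" and q: "0 < q"
      let ?K = "{z \<in> closure \<Omega>. q * snd z \<le> A R * ((norm (fst z - 0))\<^sup>2 + (snd z)\<^sup>2) + B R}"
      show "?K \<subseteq> hyp_space"
      proof
        fix z assume "z \<in> ?K"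
        then show "z \<in> hyp_space"
          using nz[of "fst z"] cl[of z] by (cases z) (auto simp: hyp_space_def less_le)
      qed
      have "norm z \<le> R" if "z \<in> ?K" for z
      proof -
        have "0 \<le> q * snd z" using cl that q by simp
        with that have "0 \<le> A R * (norm z)\<^sup>2 + B R" by (simp add: norm_z)
        then have "(norm z)\<^sup>2 \<le> R\<^sup>2"
          using R by (simp add: A_def B_def field_simps power2_eq_square)
        then show ?thesis using R by (simp add: power2_le_iff_abs_le)
      qed
      then show "bounded ?K" by (rule boundedI)
    next
      show "4 * A R * B R = - 1" if "0 < R" for R using that by (simp add: A_def B_def)
      have "filterlim (\<lambda>R. (- 1 / (2 * R) * N + R / 2) / snd z0) at_top at_top" for N
        using t0 by real_asymp
      then show "filterlim (\<lambda>R. hyperplane_height (A R) (B R) 0 z0) at_top at_top"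
        by (simp add: hyperplane_height_def A_def B_def)
    qed
  next
    case (Some y)
    then have nz: "x = y" if "(x, 0) \<in> closure \<Omega>" for x
      using p that by (auto simp: ideal_boundary_def set_eq_iff)
    have bd: "bounded \<Omega>" using p Some by (auto simp: ideal_boundary_def set_eq_iff)
    \<comment> \<open>For \<open>p\<close> at \<open>y\<close>: the hemisphere of radius 1/R about
      (y, 0), with Q positive outside.\<close>
    define A B :: "real \<Rightarrow> real" where "A = (\<lambda>R. R / 2)" and "B = (\<lambda>R. - 1 / (2 * R))"
    show ?thesis
    proof (rule that[of A B y])
      fix R q :: real assume R: "0 < R" and q: "0 < q"
      let ?K = "{z \<in> closure \<Omega>. q * snd z \<le> A R * ((norm (fst z - y))\<^sup>2 + (snd z)\<^sup>2) + B R}"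
      show "bounded ?K" using bd by (rule bounded_subset[OF bounded_closure]) auto
      show "?K \<subseteq> hyp_space"
      proof
        fix z assume z: "z \<in> ?K"
        \<comment> \<open>A point with \<open>snd z = 0\<close> could only be (y, 0), where the
          defining inequality of \<open>?K\<close> reads 0 <= -1/(2R).\<close>
        have "snd z \<noteq> 0"
        proof
          assume "snd z = 0"
          with z R nz[of "fst z"] show False by (cases z) (auto simp: B_def divide_simps)
        qed
        then show "z \<in> hyp_space" using cl[of z] z by (auto simp: hyp_space_def)
      qed
    next
      show "4 * A R * B R = - 1" if "0 < R" for R using that by (simp add: A_def B_def)
      have "filterlim (\<lambda>R. (R / 2 * N + - 1 / (2 * R)) / snd z0) at_top at_top" if "N > 0" for N
        using t0 that by real_asymp
      moreover have "0 < (norm (fst z0 - y))\<^sup>2 + (snd z0)\<^sup>2"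
        using t0 by (intro add_nonneg_pos) auto
      ultimately show "filterlim (\<lambda>R. hyperplane_height (A R) (B R) y z0) at_top at_top"
        unfolding hyperplane_height_def A_def B_def by blast
    qed
  qed
qed

section \<open>Vanishing of \<open>u\<close> at every point, by letting the hyperplanes
  shrink\<close>

theorem mainTheorem5:
  fixes \<Omega> :: "('a::euclidean_space \<times> real) set" and p :: "'a option" and lam :: real
  assumes "open \<Omega>" and "connected \<Omega>" and "\<Omega> \<subseteq> hyp_space"
    and "ideal_boundary \<Omega> = {p}"
    and "0 \<le> lam" and "lam \<le> (real (DIM('a) + 1) - 1)^2 / 4"
  shows "\<not> (\<exists>u :: 'a \<times> real \<Rightarrow> real.
            bounded (u ` hyp_closure \<Omega>) \<and>
            continuous_on (hyp_closure \<Omega>) u \<and>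
            C2_on \<Omega> u \<and>
            (\<forall>x\<in>\<Omega>. - hyp_laplacian u x = lam * u x) \<and>
            (\<forall>x\<in>hyp_frontier \<Omega>. u x = 0) \<and>
            (\<exists>x\<in>\<Omega>. u x \<noteq> 0))"
proof (rule notI, elim exE conjE bexE)
  fix u :: "'a \<times> real \<Rightarrow> real" and z0
  assume bdd: "bounded (u ` hyp_closure \<Omega>)" and cont: "continuous_on (hyp_closure \<Omega>) u"
    and C2: "C2_on \<Omega> u" and eq: "\<forall>x\<in>\<Omega>. - hyp_laplacian u x = lam * u x"
    and zero: "\<forall>x\<in>hyp_frontier \<Omega>. u x = 0" and z0: "z0 \<in> \<Omega>" "u z0 \<noteq> 0"
  define a where "a = real DIM('a) / 2"
  have a: "0 < a" by (simp add: a_def)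
  have lam: "lam \<le> a\<^sup>2" using assms(6) by (simp add: a_def power_divide)
  obtain M where M: "0 < M" "\<And>z. z \<in> hyp_closure \<Omega> \<Longrightarrow> \<bar>u z\<bar> \<le> M"
    using bdd unfolding bounded_pos by auto
  \<comment> \<open>With this sign \<open>c * u z0\<close> equals the absolute value of
    \<open>u z0\<close>, so an upper bound suffices.\<close>
  define c where "c = sgn (u z0)"
  have cM: "c * u z \<le> M" if "z \<in> hyp_closure \<Omega>" for z
    using M(2)[OF that] by (auto simp: c_def sgn_if)
  \<comment> \<open>The summand 1 places \<open>q0\<close> strictly above the supersolution
    threshold and also in the range \<open>1 \<le> q0\<close> where the barrier is positive.\<close>
  define q0 where "q0 = 2 * a * (a + 1) + 1"
  have q0: "1 \<le> q0" "2 * a * (a + 1) < q0" using a by (auto simp: q0_def)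
  show False
  proof (rule hyperplane_heights_tendsto[OF assms(3,4) z0(1)])
    fix A B :: "real \<Rightarrow> real" and y
    assume AB: "\<And>R. 0 < R \<Longrightarrow> 4 * A R * B R = - 1"
      and K: "\<And>R q. 0 < R \<Longrightarrow> 0 < q \<Longrightarrow>
         bounded {z \<in> closure \<Omega>. q * snd z \<le> A R * ((norm (fst z - y))\<^sup>2 + (snd z)\<^sup>2) + B R}"
        "\<And>R q. 0 < R \<Longrightarrow> 0 < q \<Longrightarrow>
         {z \<in> closure \<Omega>. q * snd z \<le> A R * ((norm (fst z - y))\<^sup>2 + (snd z)\<^sup>2) + B R} \<subseteq> hyp_space"
      and lim: "filterlim (\<lambda>R. hyperplane_height (A R) (B R) y z0) at_top at_top"
    let ?bound = "\<lambda>R. M / profile a q0 * profile a (hyperplane_height (A R) (B R) y z0)"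
    have le: "\<bar>u z0\<bar> \<le> ?bound R"
      if R: "0 < R" "q0 \<le> hyperplane_height (A R) (B R) y z0" for R
    proof -
      have q0_pos: "0 < q0" using q0 by simp
      have "c * u z0 \<le> ?bound R"
        using bounded_le_profile[OF assms(1,3) lam[unfolded a_def] cont C2 bspec[OF eq]
            bspec[OF zero] less_imp_le[OF M(1)] cM AB[OF R(1)] q0[unfolded a_def]
            K[OF R(1) q0_pos] z0(1) R(2)]
        unfolding a_def .
      moreover have "c * u z0 = \<bar>u z0\<bar>"
        by (simp add: c_def mult.commute abs_sgn)
      ultimately show ?thesis by linarith
    qed
    \<comment> \<open>Since \<open>M\<close> and \<open>q0\<close> do not depend on
      \<open>R\<close>, the bound at the fixed point \<open>z0\<close> tends to 0 as its height
      tends to infinity.\<close>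
    have "\<forall>\<^sub>F R in at_top. q0 \<le> hyperplane_height (A R) (B R) y z0"
      using lim by (simp only: filterlim_at_top)
    with eventually_gt_at_top[of 0] have ev: "\<forall>\<^sub>F R in at_top. \<bar>u z0\<bar> \<le> ?bound R"
      by eventually_elim (rule le)
    have lim_bound: "(?bound \<longlongrightarrow> M / profile a q0 * 0) at_top"
      by (intro tendsto_mult tendsto_const filterlim_compose[OF profile_tendsto_0[OF a] lim])
    have "\<bar>u z0\<bar> \<le> M / profile a q0 * 0"
      by (rule tendsto_lowerbound[OF lim_bound ev]) simp
    then show False using z0(2) by simp
  qed
qed

end
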